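(* Let $\|\cdot\|$ be a norm on $\mathbb R^n$, with open balls $B_r(x)$, let $\Omega$ be an open neighborhood of the origin $0_n$, and let $w$ be a vanishing weight at $0_n$ of domain $\Omega$ which is infinitesimally even at $0_n$. Set $\mu:=w\mathscr L^n$ and consider $(\Omega,\|\cdot\|,\mu)$. Assume that the probability measures $$\nu_r:=\left(\frac{w(r\,\cdot)\,r^n}{\mu(B_r(0_n))}\right)\mathscr L^n|_{B_1(0_n)}$$ weakly converge as $r\downarrow0$ to some Radon measure $\nu$ supported in $B_1(0_n)$. Then for any function $u:\Omega\to\mathbb R$ two times differentiable at $0_n$, the pointwise AMV Laplacian of $u$ at $0_n$ exists and satisfies $$\Delta^{\|\cdot\|}_\mu u(0_n)=\frac12\mathrm{Tr}\big(M_\nu\nabla^2u(0_n)\big),\qquad M_\nu:=\left(\int_{B_1(0_n)}y_iy_j\,d\nu(y)\right)_{1\le i,j\le n}.$$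
   Context: $\mathscr L^n$ is Lebesgue measure; $w\mathscr L^n$ is the measure with density $w$; $\fint_A f\,d\mu:=\frac1{\mu(A)}\int_A f\,d\mu$. Vanishing weight at $0_n$: a Lebesgue integrable function $w$ on a neighborhood $\Omega$ of $0_n$ such that $w(x)>0$ for $\mathscr L^n$-a.e. $x\in\Omega$ and $0_n$ is a Lebesgue point of $w$ with value $0$, i.e. $\lim_{r\downarrow0}\fint_{B_r(0_n)}|w|\,d\mathscr L^n=0$. Infinitesimally even at $0_n$: $w$ is $\mathscr L^n$-essentially bounded in a neighborhood of $0_n$ and $$\mathscr L^n\text{-}\operatorname*{ess\,sup}_{x\in B_r(0_n)}|w(x)-w(-x)|=o\left(r\fint_{B_r(0_n)}w\,d\mathscr L^n\right)\quad\text{as }r\downarrow0.$$ Weak convergence: the $\nu_r$ are regarded as Radon measures on $\mathbb R^n$ and convergence is tested against $C_c(\mathbb R^n)$; "$\nu$ supported in $B_1(0_n)$" means $\nu(\mathbb R^n\setminus B_1(0_n))=0$. "$u$ two times differentiable at $0_n$" means that $u$ is differentiable in a neighborhood of $0_n$ and its gradient is differentiable at $0_n$. The pointwise AMV Laplacian of $u$ at $0_n$ exists if the finite limit $$\Delta^{\|\cdot\|}_\mu u(0_n):=\lim_{r\downarrow0}\frac1{r^2}\fint_{B_r(0_n)}(u(y)-u(0_n))\,d\mu(y)$$ exists. *)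

theory Defs
  imports "HOL-Probability.Essential_Supremum" "HOL-Library.Landau_Symbols"
begin

definition is_norm :: "('a::real_vector \<Rightarrow> real) \<Rightarrow> bool" where
  "is_norm N \<longleftrightarrow>
     (\<forall>x. 0 \<le> N x) \<and>
     (\<forall>x. N x = 0 \<longleftrightarrow> x = 0) \<and>
     (\<forall>c x. N (c *\<^sub>R x) = \<bar>c\<bar> * N x) \<and>
     (\<forall>x y. N (x + y) \<le> N x + N y)"

definition nball :: "('a::real_vector \<Rightarrow> real) \<Rightarrow> 'a \<Rightarrow> real \<Rightarrow> 'a set" where
  "nball N x r = {y. N (y - x) < r}"

definition avg_integral :: "'a measure \<Rightarrow> 'a set \<Rightarrow> ('a \<Rightarrow> real) \<Rightarrow> real" where
  "avg_integral M A f = (LINT y:A|M. f y) / measure M A"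

text \<open>A function on a set \<open>\<Omega>\<close> is represented by a total function. All notions
  below depend only on its values near the origin or inside \<open>\<Omega>\<close>: balls of radius \<open>r\<close> enter
  only in the limit \<open>r \<down> 0\<close>, hence are eventually contained in \<open>\<Omega>\<close>.\<close>

definition vanishing_weight ::
    "('a::euclidean_space \<Rightarrow> real) \<Rightarrow> 'a set \<Rightarrow> ('a \<Rightarrow> real) \<Rightarrow> bool" where
  "vanishing_weight N \<Omega> w \<longleftrightarrow>
     0 \<in> interior \<Omega> \<and>
     integrable (lebesgue_on \<Omega>) w \<and>
     (AE x in lebesgue_on \<Omega>. 0 < w x) \<and>
     ((\<lambda>r. avg_integral lebesgue (nball N 0 r) (\<lambda>x. \<bar>w x\<bar>)) \<longlongrightarrow> 0) (at_right 0)"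

text \<open>By the first conjunct, the essential suprema in the second one are finite for small \<open>r\<close>,
  so that \<^const>\<open>real_of_ereal\<close> loses nothing.\<close>

definition infinitesimally_even ::
    "('a::euclidean_space \<Rightarrow> real) \<Rightarrow> ('a \<Rightarrow> real) \<Rightarrow> bool" where
  "infinitesimally_even N w \<longleftrightarrow>
     (\<exists>U C. open U \<and> 0 \<in> U \<and> (AE x in lebesgue_on U. \<bar>w x\<bar> \<le> C)) \<and>
     (\<lambda>r. real_of_ereal (esssup (lebesgue_on (nball N 0 r)) (\<lambda>x. ereal \<bar>w x - w (- x)\<bar>)))
       \<in> o[at_right 0](\<lambda>r. r * avg_integral lebesgue (nball N 0 r) w)"

definition weighted_lebesgue ::
    "'a::euclidean_space set \<Rightarrow> ('a \<Rightarrow> real) \<Rightarrow> 'a measure" where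
  "weighted_lebesgue \<Omega> w = density (lebesgue_on \<Omega>) (\<lambda>x. ennreal (w x))"

definition blowup_measure ::
    "('a::euclidean_space \<Rightarrow> real) \<Rightarrow> 'a set \<Rightarrow> ('a \<Rightarrow> real) \<Rightarrow> real \<Rightarrow> 'a measure" where
  "blowup_measure N \<Omega> w r =
     density lebesgue (\<lambda>y. indicator (nball N 0 1) y *
       ennreal (w (r *\<^sub>R y) * r ^ DIM('a) / measure (weighted_lebesgue \<Omega> w) (nball N 0 r)))"

definition radon_measure :: "'a::t2_space measure \<Rightarrow> bool" where
  "radon_measure M \<longleftrightarrow>
     sets M = sets borel \<and>
     (\<forall>K. compact K \<longrightarrow> emeasure M K < \<infinity>) \<and>
     (\<forall>A\<in>sets borel. emeasure M A = (SUP K\<in>{K. K \<subseteq> A \<and> compact K}. emeasure M K))"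

definition weakly_converges ::
    "('i \<Rightarrow> 'a::t2_space measure) \<Rightarrow> 'a measure \<Rightarrow> 'i filter \<Rightarrow> bool" where
  "weakly_converges Ms M F \<longleftrightarrow>
     (\<forall>\<phi>::'a \<Rightarrow> real. continuous_on UNIV \<phi> \<longrightarrow> compact (closure {x. \<phi> x \<noteq> 0}) \<longrightarrow>
        ((\<lambda>i. \<integral>x. \<phi> x \<partial>Ms i) \<longlongrightarrow> (\<integral>x. \<phi> x \<partial>M)) F)"

definition gradient :: "('a::real_inner \<Rightarrow> real) \<Rightarrow> 'a \<Rightarrow> 'a" where
  "gradient u x = (THE D. GDERIV u x :> D)"

definition twice_differentiable_at :: "('a::real_inner \<Rightarrow> real) \<Rightarrow> 'a \<Rightarrow> bool" where
  "twice_differentiable_at u x \<longleftrightarrow>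
     (\<forall>\<^sub>F y in nhds x. u differentiable (at y)) \<and> gradient u differentiable (at x)"

definition hessian :: "(real ^ 'n \<Rightarrow> real) \<Rightarrow> real ^ 'n \<Rightarrow> real ^ 'n ^ 'n" where
  "hessian u x = jacobian (gradient u) (at x)"

definition amv_quotient ::
    "('a::real_vector \<Rightarrow> real) \<Rightarrow> 'a measure \<Rightarrow> ('a \<Rightarrow> real) \<Rightarrow> 'a \<Rightarrow> real \<Rightarrow> real" where
  "amv_quotient N M u x r = 1 / r\<^sup>2 * avg_integral M (nball N x r) (\<lambda>y. u y - u x)"

text \<open>The first conjunct is needed because the Bochner integral of a non-integrable function
  is \<open>0\<close> by convention.\<close>

definition amv_laplacian_exists ::
    "('a::real_vector \<Rightarrow> real) \<Rightarrow> 'a measure \<Rightarrow> ('a \<Rightarrow> real) \<Rightarrow> 'a \<Rightarrow> bool" where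
  "amv_laplacian_exists N M u x \<longleftrightarrow>
     (\<forall>\<^sub>F r in at_right 0. set_integrable M (nball N x r) (\<lambda>y. u y - u x)) \<and>
     (\<exists>L. (amv_quotient N M u x \<longlongrightarrow> L) (at_right 0))"

definition amv_laplacian ::
    "('a::real_vector \<Rightarrow> real) \<Rightarrow> 'a measure \<Rightarrow> ('a \<Rightarrow> real) \<Rightarrow> 'a \<Rightarrow> real" where
  "amv_laplacian N M u x = Lim (at_right 0) (amv_quotient N M u x)"

definition moment_matrix ::
    "(real ^ 'n \<Rightarrow> real) \<Rightarrow> (real ^ 'n) measure \<Rightarrow> real ^ 'n ^ 'n" where
  "moment_matrix N \<nu> = (\<chi> i j. LINT y:nball N 0 1|\<nu>. y $ i * y $ j)"

end

theory Submission
  imports Defs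
begin

text \<open>Insert the second-order Taylor expansion of \<open>u\<close> at \<open>0\<close> into the average over the ball of
  radius \<open>r\<close>. The linear term only sees the odd part of the weight, so infinitesimal evenness makes
  it \<open>o(r\<^sup>2)\<close>. After rescaling the ball to radius \<open>1\<close>, the quadratic term is the integral of a
  quadratic form against the blow-up measure; multiplying the form by a cutoff that equals \<open>1\<close> on the
  unit ball makes it an admissible test function for the weak convergence. The Taylor
  remainder is \<open>o(r\<^sup>2)\<close> uniformly on the ball.\<close>

text \<open>The obstacle is the linear term. Divided by r^2 it is a priori of order 1/r, and
  smallness of the weight gives nothing, since the average is normalised by the mass of the same
  weight; only cancellation under reflection helps. Bounding the odd difference of the weight by its
  essential supremum \<open>e\<close> leaves a multiple of \<open>e\<close> over r times the
  Lebesgue average of \<open>w\<close>, which is the quotient that infinitesimal evenness sends to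
  0.

  The data are only local: \<open>w\<close> is controlled on \<Omega> and up to null sets,
  \<open>u\<close> near the origin. The weight is therefore replaced by \<open>W\<close>, its
  positive part extended by 0, a total integrable function on which reflection and dilation act;
  \<open>u\<close> enters only through a compact Euclidean ball on which it is continuous. Balls are
  those of \<open>N\<close> while Taylor estimates use the Euclidean norm, and a single constant
  \<open>C\<close> compares the two.\<close>

section \<open>Comparison of a norm with the Euclidean norm\<close>

text \<open>The triangle inequality over a basis gives the upper bound, so \<open>N\<close> is
  Lipschitz and hence continuous; compactness of the Euclidean sphere then gives \<open>N\<close> a
  positive minimum there, and homogeneity turns this into the lower bound.\<close>

lemma is_norm_bounds:
  fixes N :: "'a::euclidean_space \<Rightarrow> real"
  assumes "is_norm N"
  obtains C where "C > 0" "\<And>x. N x \<le> C * norm x" "\<And>x. norm x \<le> C * N x"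
    and "continuous_on UNIV N"
proof -
  have nonneg: "0 \<le> N x" and zero_iff: "N x = 0 \<longleftrightarrow> x = 0"
    and scale: "N (c *\<^sub>R x) = \<bar>c\<bar> * N x" and tri: "N (x + y) \<le> N x + N y" for c x y
    using assms unfolding is_norm_def by blast+
  define K where "K = (\<Sum>b\<in>Basis. N (b::'a))"
  have "K \<ge> 0"
    unfolding K_def by (intro sum_nonneg nonneg)
  have sum_le: "N (\<Sum>b\<in>S. f b) \<le> (\<Sum>b\<in>S. N (f b))" if "finite S" for S and f :: "'a \<Rightarrow> 'a"
    using that
  proof (induction S rule: finite_induct)
    case empty
    then show ?case using zero_iff[of 0] by simp
  next
    case (insert b S)
    then show ?case using tri[of "f b" "sum f S"] by simp
  qed
  have upper: "N x \<le> K * norm x" for x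
  proof -
    have "N x = N (\<Sum>b\<in>Basis. (x \<bullet> b) *\<^sub>R b)"
      by (simp add: euclidean_representation)
    also have "\<dots> \<le> (\<Sum>b\<in>Basis. \<bar>x \<bullet> b\<bar> * N b)"
      using sum_le[of Basis "\<lambda>b. (x \<bullet> b) *\<^sub>R b"] by (simp add: scale)
    also have "\<dots> \<le> (\<Sum>b\<in>Basis. norm x * N b)"
      by (intro sum_mono mult_right_mono nonneg Basis_le_norm)
    finally show ?thesis
      by (simp add: K_def sum_distrib_left mult.commute)
  qed
  have "N x - N y \<le> K * dist x y" for x y
    using tri[of "x - y" y] upper[of "x - y"] by (simp add: dist_norm)
  from this this[of y x for x y] have lip: "dist (N x) (N y) \<le> K * dist x y" for x y
    by (smt (verit) dist_commute dist_real_def)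
  have cont: "continuous_on UNIV N"
    using \<open>K \<ge> 0\<close> lip by (intro lipschitz_on_continuous_on lipschitz_onI) auto
  obtain b :: 'a where b: "b \<in> Basis"
    using nonempty_Basis by blast
  have "sphere (0::'a) 1 \<noteq> {}"
    using b by (auto simp: dist_norm intro!: exI[of _ b])
  then have "\<exists>z\<in>sphere 0 1. \<forall>y\<in>sphere 0 1. N z \<le> N y"
    using cont continuous_on_subset by (intro continuous_attains_inf) auto
  then obtain z where z: "z \<in> sphere 0 1" "\<And>y. y \<in> sphere 0 1 \<Longrightarrow> N z \<le> N y"
    by blast
  have "N z > 0"
    using z(1) zero_iff[of z] nonneg[of z] by (cases "z = 0") (auto simp: less_le)
  have lower: "norm x \<le> 1 / N z * N x" for x
  proof (cases "x = 0")
    case False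
    have "N z \<le> N ((1 / norm x) *\<^sub>R x)"
      using False by (intro z(2)) simp
    then show ?thesis
      using False \<open>N z > 0\<close> by (simp add: scale field_simps)
  qed (use zero_iff[of x] in simp)
  show ?thesis
  proof (rule that[of "max 1 (max K (1 / N z))"])
    show "N x \<le> max 1 (max K (1 / N z)) * norm x" for x
      by (rule order_trans[OF upper]) (intro mult_right_mono, auto)
    show "norm x \<le> max 1 (max K (1 / N z)) * N x" for x
      by (rule order_trans[OF lower]) (intro mult_right_mono nonneg, auto)
  qed (use cont in auto)
qed

section \<open>Lebesgue measure under dilations and reflections\<close>

text \<open>Stated for the completed measure because \<open>w\<close> is only Lebesgue measurable.
  The factor \<open>c\<close> will be -1 for the reflection in the linear term and \<open>r\<close>
  for the blow-up.\<close>

lemma lebesgue_scaling: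
  assumes "c \<noteq> 0"
  shows "(lebesgue :: 'a::euclidean_space measure)
    = density (distr lebesgue lebesgue ((*\<^sub>R) c)) (\<lambda>_. ennreal (\<bar>c\<bar> ^ DIM('a)))"
proof -
  \<comment> \<open>The affine change of variables allows a separate factor for each coordinate and
    a translation; equal factors and translation 0 give the dilation.\<close>
  have eq: "(\<lambda>x::'a. 0 + (\<Sum>j\<in>Basis. (c * (x \<bullet> j)) *\<^sub>R j)) = (*\<^sub>R) c"
    unfolding scaleR_scaleR[symmetric] scaleR_sum_right[symmetric] euclidean_representation
    by simp
  show ?thesis
    using lebesgue_affine_euclidean[of "\<lambda>_. c" "0::'a"] assms unfolding eq by simp
qed

lemma lebesgue_integral_scaling:
  fixes f :: "'a::euclidean_space \<Rightarrow> real"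
  assumes [measurable]: "f \<in> borel_measurable lebesgue" and "c \<noteq> 0"
  shows "(LINT x|lebesgue. f x) = \<bar>c\<bar> ^ DIM('a) * (LINT x|lebesgue. f (c *\<^sub>R x))"
proof -
  have "(LINT x|lebesgue. f x)
    = (LINT x|density (distr lebesgue lebesgue ((*\<^sub>R) c)) (\<lambda>_. ennreal (\<bar>c\<bar> ^ DIM('a))). f x)"
    using lebesgue_scaling[OF \<open>c \<noteq> 0\<close>, where 'a = 'a] by simp
  also have "\<dots> = (LINT x|lebesgue. \<bar>c\<bar> ^ DIM('a) *\<^sub>R f (c *\<^sub>R x))"
    by (subst integral_density) (auto simp: integral_distr)
  finally show ?thesis by simp
qed

lemma lebesgue_integrable_scaling:
  fixes f :: "'a::euclidean_space \<Rightarrow> real"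
  assumes "integrable lebesgue f" and "c \<noteq> 0"
  shows "integrable lebesgue (\<lambda>x. f (c *\<^sub>R x))"
proof -
  have [measurable]: "f \<in> borel_measurable lebesgue"
    using assms by simp
  have "integrable (density (distr lebesgue lebesgue ((*\<^sub>R) c)) (\<lambda>_. ennreal (\<bar>c\<bar> ^ DIM('a)))) f"
    using lebesgue_scaling[OF \<open>c \<noteq> 0\<close>, where 'a = 'a] assms by simp
  then show ?thesis
    using \<open>c \<noteq> 0\<close> by (subst (asm) integrable_density) (auto simp: integrable_distr_eq)
qed

lemma AE_lebesgue_scaling:
  fixes P :: "'a::euclidean_space \<Rightarrow> bool"
  assumes "AE x in lebesgue. P x" and "c \<noteq> 0"
  shows "AE x in lebesgue. P (c *\<^sub>R x)"
proof -
  obtain S where S: "{x. \<not> P x} \<subseteq> S" "S \<in> null_sets lebesgue"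
    using assms(1) by (auto simp: eventually_ae_filter)
  \<comment> \<open>The preimage of \<open>S\<close> under the dilation is written as an image under
    the inverse dilation, the form in which its measure is known; its measurability is read off from
    the preimage.\<close>
  have "(\<lambda>x. (1 / c) *\<^sub>R x + 0) ` S \<in> null_sets lebesgue"
  proof (rule null_setsI)
    show "emeasure lebesgue ((\<lambda>x. (1 / c) *\<^sub>R x + 0) ` S) = 0"
      using S(2) unfolding emeasure_lebesgue_affine by auto
    have "(\<lambda>x. (1 / c) *\<^sub>R x + 0) ` S = (*\<^sub>R) c -` S \<inter> space lebesgue"
      using assms(2) by (force simp: image_iff)
    then show "(\<lambda>x. (1 / c) *\<^sub>R x + 0) ` S \<in> sets lebesgue"
      using null_setsD2[OF S(2)] measurable_sets[OF lebesgue_measurable_scaling] by auto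
  qed
  moreover have "{x \<in> space lebesgue. \<not> P (c *\<^sub>R x)} \<subseteq> (\<lambda>x. (1 / c) *\<^sub>R x + 0) ` S"
    using S(1) assms(2) by (force simp: image_iff)
  ultimately show ?thesis
    by (rule AE_I')
qed

section \<open>Gradient and second-order expansion\<close>

text \<open>\<open>gradient\<close> is a definite description, so it carries information only once
  existence and uniqueness are known; the vector representing the linear form \<open>f\<close> is
  \<open>adjoint f 1\<close>.\<close>

lemma gderiv_gradient:
  fixes u :: "'a::euclidean_space \<Rightarrow> real"
  assumes "u differentiable (at x)"
  shows "GDERIV u x :> gradient u x"
proof -
  obtain f where f: "(u has_derivative f) (at x)"
    using assms by (auto simp: differentiable_def)
  then have "linear f"
    by (rule has_derivative_linear)
  then have "f = (\<lambda>h. h \<bullet> adjoint f 1)"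
    by (simp add: fun_eq_iff adjoint_works)
  with f have ex: "GDERIV u x :> adjoint f 1"
    by (simp add: gderiv_def)
  have "D = adjoint f 1" if "GDERIV u x :> D" for D
  proof -
    have "(\<lambda>h. h \<bullet> D) = (\<lambda>h. h \<bullet> adjoint f 1)"
      using has_derivative_unique ex that unfolding gderiv_def by blast
    then show ?thesis
      by (metis vector_eq_ldot)
  qed
  then show ?thesis
    unfolding gradient_def using ex by (metis theI)
qed

text \<open>The mean value theorem along the segment from \<open>0\<close> to \<open>y\<close> reduces the claim to the first-order
  expansion of the gradient, so the symmetry of the Hessian is not used.\<close>

lemma second_order_taylor:
  fixes u :: "'a::euclidean_space \<Rightarrow> real"
  assumes "twice_differentiable_at u 0" and "\<epsilon> > 0"
  defines "H \<equiv> frechet_derivative (gradient u) (at 0)"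
  shows "\<forall>\<^sub>F y in nhds 0. \<bar>u y - u 0 - gradient u 0 \<bullet> y - H y \<bullet> y / 2\<bar> \<le> \<epsilon> * (norm y)\<^sup>2"
proof -
  have H: "(gradient u has_derivative H) (at 0)"
    using assms by (simp add: twice_differentiable_at_def frechet_derivative_works)
  then have "linear H"
    by (rule has_derivative_linear)
  obtain d1 where d1: "d1 > 0" "\<And>y. norm y < d1 \<Longrightarrow> u differentiable (at y)"
    using assms(1) by (auto simp: twice_differentiable_at_def eventually_nhds_metric)
  obtain d2 where d2: "d2 > 0"
    "\<And>y. norm y < d2 \<Longrightarrow> norm (gradient u y - gradient u 0 - H y) \<le> \<epsilon> * norm y"
    using H \<open>\<epsilon> > 0\<close> unfolding has_derivative_at_alt by (metis diff_zero)
  have "\<bar>u y - u 0 - gradient u 0 \<bullet> y - H y \<bullet> y / 2\<bar> \<le> \<epsilon> * (norm y)\<^sup>2"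
    if y: "norm y < min d1 d2" for y
  proof -
    \<comment> \<open>\<open>\<phi> 1 - \<phi> 0\<close> is the Taylor remainder at
      \<open>y\<close>, and \<open>\<phi>' t\<close> is the first-order error of the gradient at
      \<open>t *\<^sub>R y\<close>, paired with \<open>y\<close>.\<close>
    define \<phi> where "\<phi> t = u (t *\<^sub>R y) - t * (gradient u 0 \<bullet> y) - t\<^sup>2 * (H y \<bullet> y) / 2" for t
    define \<phi>' where "\<phi>' t = gradient u (t *\<^sub>R y) \<bullet> y - gradient u 0 \<bullet> y - t * (H y \<bullet> y)" for t
    have small: "norm (t *\<^sub>R y) \<le> norm y" if "0 \<le> t" "t \<le> 1" for t
      using that by (simp add: mult_left_le_one_le)
    have deriv: "(\<phi> has_real_derivative \<phi>' t) (at t)" if "0 \<le> t" "t \<le> 1" for t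
    proof -
      have "GDERIV u (t *\<^sub>R y) :> gradient u (t *\<^sub>R y)"
        using small[OF that] y by (intro gderiv_gradient d1) auto
      then have "(u has_derivative (\<lambda>h. h \<bullet> gradient u (t *\<^sub>R y))) (at (t *\<^sub>R y))"
        by (simp add: gderiv_def)
      moreover have "((\<lambda>t. t *\<^sub>R y) has_derivative (\<lambda>h. h *\<^sub>R y)) (at t)"
        by (auto intro!: derivative_eq_intros)
      ultimately have "((\<lambda>t. u (t *\<^sub>R y)) has_derivative (\<lambda>h. (h *\<^sub>R y) \<bullet> gradient u (t *\<^sub>R y))) (at t)"
        by (rule has_derivative_compose[rotated])
      then have "((\<lambda>t. u (t *\<^sub>R y)) has_real_derivative (gradient u (t *\<^sub>R y) \<bullet> y)) (at t)"
        by (simp add: has_field_derivative_def inner_commute mult_commute_abs)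
      then show ?thesis
        unfolding \<phi>_def \<phi>'_def by (auto intro!: derivative_eq_intros)
    qed
    obtain t where t: "0 < t" "t < 1" "\<phi> 1 - \<phi> 0 = (1 - 0) * \<phi>' t"
      using MVT2[of 0 1 \<phi> \<phi>'] deriv by auto
    have "\<phi>' t = (gradient u (t *\<^sub>R y) - gradient u 0 - H (t *\<^sub>R y)) \<bullet> y"
      by (simp add: \<phi>'_def inner_diff_left linear_scale[OF \<open>linear H\<close>])
    also have "\<bar>\<dots>\<bar> \<le> (\<epsilon> * norm (t *\<^sub>R y)) * norm y"
      using small[of t] t y
      by (intro order_trans[OF Cauchy_Schwarz_ineq2] mult_right_mono d2) auto
    also have "\<dots> \<le> (\<epsilon> * norm y) * norm y"
      using small[of t] t \<open>\<epsilon> > 0\<close> by (intro mult_right_mono mult_left_mono) auto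
    finally show ?thesis
      using t(3) by (simp add: \<phi>_def power2_eq_square)
  qed
  then show ?thesis
    using d1(1) d2(1) by (auto simp: eventually_nhds_metric intro!: exI[of _ "min d1 d2"])
qed

section \<open>Small balls of the norm\<close>

lemma is_norm_scaleR: "is_norm N \<Longrightarrow> N (c *\<^sub>R x) = \<bar>c\<bar> * N x"
  unfolding is_norm_def by blast

lemma is_norm_minus: "is_norm N \<Longrightarrow> N (- x) = N x"
  using is_norm_scaleR[of N "-1" x] by simp

lemma is_norm_zero: "is_norm N \<Longrightarrow> N 0 = 0"
  unfolding is_norm_def by blast

lemma open_nball:
  fixes N :: "'a::euclidean_space \<Rightarrow> real"
  assumes "is_norm N"
  shows "open (nball N 0 r)"
proof -
  obtain C where "continuous_on UNIV N"
    using is_norm_bounds[OF assms] by metis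
  then show ?thesis
    unfolding nball_def by (simp add: open_Collect_less)
qed

lemma norm_less_nball:
  fixes N :: "'a::euclidean_space \<Rightarrow> real"
  assumes "C > 0" "\<And>x. norm x \<le> C * N x" and "x \<in> nball N 0 r"
  shows "norm x < C * r"
proof -
  have "C * N x < C * r"
    using assms(1,3) by (simp add: nball_def)
  with assms(2)[of x] show ?thesis
    by linarith
qed

lemma lmeasurable_nball:
  fixes N :: "'a::euclidean_space \<Rightarrow> real"
  assumes "is_norm N"
  shows "nball N 0 r \<in> lmeasurable"
proof -
  obtain C where C: "C > 0" "\<And>x. norm x \<le> C * N x"
    using is_norm_bounds[OF assms] by metis
  have "bounded (nball N 0 r)"
    unfolding bounded_iff using norm_less_nball[OF C] less_imp_le by blast
  then show ?thesis
    using open_nball[OF assms] by (intro lmeasurable_open)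
qed

lemma measure_nball_pos:
  fixes N :: "'a::euclidean_space \<Rightarrow> real"
  assumes "is_norm N" and "r > 0"
  shows "measure lebesgue (nball N 0 r) > 0"
proof -
  have "0 \<in> nball N 0 r"
    using assms by (simp add: nball_def is_norm_zero)
  then have "\<not> negligible (nball N 0 r)"
    using open_nball[OF assms(1)] open_not_negligible by blast
  then show ?thesis
    using lmeasurable_nball[OF assms(1)] negligible_iff_measure zero_less_measure_iff by blast
qed

text \<open>Turns every local hypothesis (domain and local bound of the weight, Taylor estimate)
  into a statement about small radii: a ball of radius \<open>r\<close> lies in the Euclidean ball
  of radius \<open>C * r\<close>.\<close>

lemma eventually_nball_subset:
  fixes N :: "'a::euclidean_space \<Rightarrow> real"
  assumes "is_norm N" and "open S" and "0 \<in> S"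
  shows "\<forall>\<^sub>F r in at_right 0. nball N 0 r \<subseteq> S"
proof -
  obtain C where C: "C > 0" "\<And>x. norm x \<le> C * N x"
    using is_norm_bounds[OF assms(1)] by metis
  obtain d where d: "d > 0" "ball 0 d \<subseteq> S"
    using assms by (meson open_contains_ball)
  have "nball N 0 r \<subseteq> S" if "r < d / C" for r
  proof
    fix x assume "x \<in> nball N 0 r"
    from norm_less_nball[OF C this] have "norm x < d"
      using that C(1) by (simp add: field_simps)
    then show "x \<in> S"
      using d(2) by auto
  qed
  then show ?thesis
    using d C by (auto simp: eventually_at_right_field intro!: exI[of _ "d / C"])
qed

section \<open>The linear term and the odd part of the weight\<close>

text \<open>Measurability and boundedness of \<open>f\<close> are asked on \<open>A\<close> only,
  since \<open>u\<close> may be arbitrary away from the origin.\<close>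

lemma set_integrable_mult_bounded:
  fixes W f :: "'a \<Rightarrow> real"
  assumes W: "integrable M W" and A[measurable]: "A \<in> sets M"
    and f[measurable]: "set_borel_measurable M A f"
    and K: "\<And>x. x \<in> A \<Longrightarrow> \<bar>f x\<bar> \<le> K"
  shows "set_integrable M A (\<lambda>x. W x * f x)"
  unfolding set_integrable_def
proof (rule Bochner_Integration.integrable_bound[of _ "\<lambda>x. K * W x"])
  have [measurable]: "W \<in> borel_measurable M"
    using W by simp
  have "(\<lambda>x. W x * (indicator A x *\<^sub>R f x)) \<in> borel_measurable M"
    using f unfolding set_borel_measurable_def by measurable
  then show "(\<lambda>x. indicator A x *\<^sub>R (W x * f x)) \<in> borel_measurable M"
    by (simp add: mult.left_commute)
  show "AE x in M. norm (indicator A x *\<^sub>R (W x * f x)) \<le> norm (K * W x)"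
  proof (intro AE_I2)
    fix x
    show "norm (indicator A x *\<^sub>R (W x * f x)) \<le> norm (K * W x)"
    proof (cases "x \<in> A")
      case True
      then have "\<bar>f x\<bar> \<le> \<bar>K\<bar>"
        using K by fastforce
      then show ?thesis
        using True mult_left_mono[of "\<bar>f x\<bar>" "\<bar>K\<bar>" "\<bar>W x\<bar>"] by (simp add: abs_mult mult.commute)
    qed auto
  qed
qed (use W in auto)

text \<open>The reflection \<open>x \<mapsto> - x\<close> turns the integral of the odd function \<open>g \<bullet> x\<close> against \<open>W\<close> into its
  integral against the odd part of \<open>W\<close>.\<close>

lemma linear_term_bound:
  fixes N :: "'a::euclidean_space \<Rightarrow> real"
  assumes N: "is_norm N" and W: "integrable lebesgue W" and "r > 0"
    and C: "C > 0" "\<And>x. norm x \<le> C * N x"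
    and e: "AE x in lebesgue. x \<in> nball N 0 r \<longrightarrow> \<bar>W x - W (- x)\<bar> \<le> e"
  shows "\<bar>LINT x:nball N 0 r|lebesgue. W x * (g \<bullet> x)\<bar>
    \<le> e * (norm g * C * r) * measure lebesgue (nball N 0 r) / 2"
proof -
  let ?B = "nball N 0 r"
  have B[measurable]: "?B \<in> sets lebesgue" and B_fin: "emeasure lebesgue ?B < \<infinity>"
    using lmeasurable_nball[OF N, of r] by (auto simp: fmeasurable_def)
  have norm_B: "norm x \<le> C * r" if "x \<in> ?B" for x
    using norm_less_nball[OF C that] by simp
  have lin: "\<bar>g \<bullet> x\<bar> \<le> norm g * C * r" if "x \<in> ?B" for x
    using Cauchy_Schwarz_ineq2[of g x] mult_left_mono[OF norm_B[OF that], of "norm g"] by simp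
  define F where "F x = indicator ?B x *\<^sub>R (W x * (g \<bullet> x))" for x
  have "(\<lambda>x. g \<bullet> x) \<in> borel_measurable lebesgue"
    by (intro measurable_completion) auto
  then have "set_borel_measurable lebesgue ?B (\<lambda>x. g \<bullet> x)"
    unfolding set_borel_measurable_def by measurable
  then have F: "integrable lebesgue F"
    using set_integrable_mult_bounded[OF W B, of "\<lambda>x. g \<bullet> x"] lin
    unfolding F_def set_integrable_def by blast
  have F_int: "integral\<^sup>L lebesgue F = (LINT x|lebesgue. F (- x))"
    using lebesgue_integral_scaling[of F "-1"] F by simp
  have F_minus: "integrable lebesgue (\<lambda>x. F (- x))"
    using lebesgue_integrable_scaling[OF F, of "-1"] by simp
  \<comment> \<open>The ball is symmetric, so both summands share one indicator and the oddness of
    the linear form produces the difference of weights. Doubling the integral of \<open>F\<close> is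
    the origin of the division by 2 in the bound.\<close>
  have F_sum: "F x + F (- x) = indicator ?B x * ((W x - W (- x)) * (g \<bullet> x))" for x
    using is_norm_minus[OF N, of x]
    by (auto simp: F_def nball_def indicator_def algebra_simps)
  have "2 * integral\<^sup>L lebesgue F = (LINT x|lebesgue. F x + F (- x))"
    using F F_minus F_int by simp
  also have "\<bar>\<dots>\<bar> \<le> (LINT x|lebesgue. indicator ?B x * (e * (norm g * C * r)))"
    unfolding real_norm_def[symmetric]
  proof (rule order_trans[OF integral_norm_bound integral_mono_AE])
    show "integrable lebesgue (\<lambda>x. indicator ?B x * (e * (norm g * C * r)))"
      using B B_fin by (intro integrable_mult_left) auto
    have "AE x in lebesgue. \<bar>F x + F (- x)\<bar> \<le> indicator ?B x * (e * (norm g * C * r))"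
      using e
    proof eventually_elim
      case (elim x)
      then show ?case
        using lin[of x] unfolding F_sum
        by (auto simp: indicator_def abs_mult intro!: mult_mono)
    qed
    then show "AE x in lebesgue. norm (F x + F (- x)) \<le> indicator ?B x * (e * (norm g * C * r))"
      by simp
  qed (use F F_minus in auto)
  also have "\<dots> = e * (norm g * C * r) * measure lebesgue ?B"
    by simp
  finally show ?thesis
    by (simp add: set_lebesgue_integral_def F_def[abs_def])
qed

text \<open>The bound \<open>K\<close> excludes the value \<infinity>, which
  \<open>real_of_ereal\<close> would send to 0; the value -\<infinity> contradicts the inequality at
  any point where it holds.\<close>

lemma AE_le_real_esssup:
  fixes f :: "'a \<Rightarrow> real"
  assumes "f \<in> borel_measurable M" and "AE x in M. f x \<le> K"
  shows "AE x in M. f x \<le> real_of_ereal (esssup M (\<lambda>x. ereal (f x)))"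
proof -
  let ?s = "esssup M (\<lambda>x. ereal (f x))"
  have "?s \<le> ereal K"
    using assms by (intro esssup_I) auto
  have "AE x in M. ereal (f x) \<le> ?s"
    by (rule esssup_AE)
  then show ?thesis
  proof eventually_elim
    case (elim x)
    with \<open>?s \<le> ereal K\<close> show ?case
      by (cases ?s) auto
  qed
qed

text \<open>On small balls both x and -x lie in the neighbourhood where \<open>w\<close> is
  essentially bounded by \<open>K\<close>, so \<open>2 * K\<close> bounds the difference and keeps
  the essential supremum finite.\<close>

lemma eventually_AE_le_real_esssup:
  fixes N :: "'a::euclidean_space \<Rightarrow> real"
  assumes N: "is_norm N" and "open \<Omega>" "0 \<in> \<Omega>"
    and w: "w \<in> borel_measurable (lebesgue_on \<Omega>)"
    and "open U" "0 \<in> U" and bd: "AE x in lebesgue_on U. \<bar>w x\<bar> \<le> K"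
  shows "\<forall>\<^sub>F r in at_right 0. AE x in lebesgue. x \<in> nball N 0 r \<longrightarrow> \<bar>w x - w (- x)\<bar>
    \<le> real_of_ereal (esssup (lebesgue_on (nball N 0 r)) (\<lambda>x. ereal \<bar>w x - w (- x)\<bar>))"
proof -
  have "\<forall>\<^sub>F r in at_right 0. nball N 0 r \<subseteq> \<Omega> \<inter> U"
    using assms by (intro eventually_nball_subset) auto
  then show ?thesis
  proof eventually_elim
    case (elim r)
    let ?B = "nball N 0 r"
    have sym: "- x \<in> ?B \<longleftrightarrow> x \<in> ?B" for x
      using is_norm_minus[OF N, of x] by (simp add: nball_def)
    have B[measurable]: "?B \<in> sets lebesgue"
      using lmeasurable_nball[OF N, of r] by (auto simp: fmeasurable_def)
    \<comment> \<open>\<open>w\<close> is measurable on \<Omega> only. Its extension by 0 is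
      measurable everywhere and agrees with \<open>w\<close> at x and -x for x in the ball.\<close>
    define w1 where "w1 x = indicator \<Omega> x *\<^sub>R w x" for x
    have w1[measurable]: "w1 \<in> borel_measurable lebesgue"
      using w \<open>open \<Omega>\<close> unfolding w1_def by (subst (asm) borel_measurable_restrict_space_iff) auto
    \<comment> \<open>The reflection is written as a dilation, whose Lebesgue measurability is
      available.\<close>
    have "(\<lambda>x. w1 ((-1) *\<^sub>R x)) \<in> borel_measurable lebesgue"
      by measurable
    then have w1'[measurable]: "(\<lambda>x. w1 (- x)) \<in> borel_measurable lebesgue"
      by simp
    have "(\<lambda>x. \<bar>w1 x - w1 (- x)\<bar>) \<in> borel_measurable (lebesgue_on ?B)"
      by (intro measurable_restrict_space1) measurable
    also have "?this \<longleftrightarrow> (\<lambda>x. \<bar>w x - w (- x)\<bar>) \<in> borel_measurable (lebesgue_on ?B)"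
      using elim sym by (intro measurable_cong) (auto simp: w1_def indicator_def space_restrict_space)
    finally have meas: "(\<lambda>x. \<bar>w x - w (- x)\<bar>) \<in> borel_measurable (lebesgue_on ?B)" .
    have bd': "AE x in lebesgue. x \<in> U \<longrightarrow> \<bar>w x\<bar> \<le> K"
      using bd \<open>open U\<close> by (subst (asm) AE_restrict_space_iff) auto
    from AE_lebesgue_scaling[OF this, of "-1"]
    have bd_minus: "AE x in lebesgue. - x \<in> U \<longrightarrow> \<bar>w (- x)\<bar> \<le> K"
      by simp
    have "AE x in lebesgue. x \<in> ?B \<longrightarrow> \<bar>w x - w (- x)\<bar> \<le> 2 * K"
      using bd' bd_minus
    proof eventually_elim
      case (elim x)
      then show ?case
        using \<open>?B \<subseteq> \<Omega> \<inter> U\<close> sym[of x] by force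
    qed
    then have "AE x in lebesgue_on ?B. \<bar>w x - w (- x)\<bar> \<le> 2 * K"
      by (subst AE_restrict_space_iff) auto
    from AE_le_real_esssup[OF meas this] show ?case
      by (subst (asm) AE_restrict_space_iff) auto
  qed
qed

section \<open>Integrals against the weighted measure and its blow-up\<close>

text \<open>\<open>ennreal\<close> sends negative reals to 0, so the measure has density
  \<open>max 0 (w x)\<close> at every point of \<Omega>. Extending by 0 moves all integrals to the
  full Lebesgue measure, where reflection and dilation act.\<close>

lemma
  fixes w f :: "'a::euclidean_space \<Rightarrow> real"
  assumes \<Omega>: "open \<Omega>" and A: "A \<in> sets lebesgue" "A \<subseteq> \<Omega>"
    and w: "w \<in> borel_measurable (lebesgue_on \<Omega>)"
    and f: "set_borel_measurable lebesgue A f"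
  defines "W \<equiv> \<lambda>x. indicator \<Omega> x * max 0 (w x)"
  shows set_integrable_weighted_lebesgue:
      "set_integrable (weighted_lebesgue \<Omega> w) A f
        \<longleftrightarrow> set_integrable lebesgue A (\<lambda>x. W x * f x)" (is ?integrable)
    and set_integral_weighted_lebesgue:
      "(LINT x:A|weighted_lebesgue \<Omega> w. f x) = (LINT x:A|lebesgue. W x * f x)" (is ?integral)
proof -
  have eq: "weighted_lebesgue \<Omega> w = density (lebesgue_on \<Omega>) (\<lambda>x. ennreal (max 0 (w x)))"
    unfolding weighted_lebesgue_def
    using w by (intro density_cong) (auto simp: max_def ennreal_neg)
  have f': "(\<lambda>x. indicator A x *\<^sub>R f x) \<in> borel_measurable (lebesgue_on \<Omega>)"
    using f unfolding set_borel_measurable_def by (rule measurable_restrict_space1)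
  have \<Omega>': "\<Omega> \<inter> space lebesgue \<in> sets lebesgue"
    using \<Omega> by simp
  have arrange: "(\<lambda>x. indicator \<Omega> x * (max 0 (w x) * (indicator A x * f x)))
      = (\<lambda>x. indicator A x * (W x * f x))"
    by (auto simp: W_def)
  show ?integrable
    unfolding set_integrable_def eq using f' w
    by (subst integrable_density) (auto simp: integrable_restrict_space[OF \<Omega>'] simp: arrange)
  show ?integral
    unfolding set_lebesgue_integral_def eq using f' w
    by (subst integral_density) (auto simp: integral_restrict_space[OF \<Omega>'] simp: arrange)
qed

lemma measure_weighted_lebesgue:
  fixes w :: "'a::euclidean_space \<Rightarrow> real"
  assumes \<Omega>: "open \<Omega>" and A: "A \<in> sets lebesgue" "A \<subseteq> \<Omega>"
    and w: "w \<in> borel_measurable (lebesgue_on \<Omega>)"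
  shows "measure (weighted_lebesgue \<Omega> w) A
    = (LINT x:A|lebesgue. indicator \<Omega> x * max 0 (w x))"
proof -
  have "set_borel_measurable lebesgue A (\<lambda>_. 1 :: real)"
    using A unfolding set_borel_measurable_def by measurable
  from set_integral_weighted_lebesgue[OF \<Omega> A w this]
  have "(LINT x:A|weighted_lebesgue \<Omega> w. 1) = (LINT x:A|lebesgue. indicator \<Omega> x * max 0 (w x))"
    by simp
  moreover have "A \<inter> space (weighted_lebesgue \<Omega> w) = A"
    using A by (auto simp: weighted_lebesgue_def space_restrict_space)
  ultimately show ?thesis
    by (simp add: set_lebesgue_integral_def)
qed

text \<open>The factor \<open>r ^ DIM('a)\<close> in the blow-up density is the Jacobian of the
  dilation by \<open>r\<close>, so it disappears on returning to the ball of radius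
  \<open>r\<close>.\<close>

lemma integral_blowup_measure:
  fixes N :: "'a::euclidean_space \<Rightarrow> real"
  assumes N: "is_norm N" and \<Omega>: "open \<Omega>" "nball N 0 r \<subseteq> \<Omega>" and "r > 0"
    and w: "w \<in> borel_measurable (lebesgue_on \<Omega>)"
    and \<phi>: "continuous_on UNIV \<phi>"
  shows "(LINT y|blowup_measure N \<Omega> w r. \<phi> y)
    = (LINT y:nball N 0 r|lebesgue. (indicator \<Omega> y * max 0 (w y)) * \<phi> ((1 / r) *\<^sub>R y))
        / measure (weighted_lebesgue \<Omega> w) (nball N 0 r)"
proof -
  define W where "W x = indicator \<Omega> x * max 0 (w x)" for x
  define m where "m = measure (weighted_lebesgue \<Omega> w) (nball N 0 r)"
  have "m \<ge> 0"
    by (simp add: m_def)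
  have nball_scale: "r *\<^sub>R y \<in> nball N 0 r \<longleftrightarrow> y \<in> nball N 0 1" for y
    using \<open>r > 0\<close> by (simp add: nball_def is_norm_scaleR[OF N])
  have B[measurable]: "nball N 0 s \<in> sets lebesgue" for s
    using lmeasurable_nball[OF N, of s] by (auto simp: fmeasurable_def)
  have W[measurable]: "W \<in> borel_measurable lebesgue"
  proof -
    have "(\<lambda>x. max 0 (w x)) \<in> borel_measurable (lebesgue_on \<Omega>)"
      using w by measurable
    then show ?thesis
      using \<Omega> unfolding W_def by (subst (asm) borel_measurable_restrict_space_iff) auto
  qed
  have \<phi>'[measurable]: "\<phi> \<in> borel_measurable lebesgue"
    using borel_measurable_continuous_onI[OF \<phi>] by (intro measurable_completion) simp
  define D where "D y = indicator (nball N 0 1) y * (W (r *\<^sub>R y) * r ^ DIM('a) / m)" for y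
  have [measurable]: "D \<in> borel_measurable lebesgue"
    unfolding D_def by measurable
  have "D y \<ge> 0" for y
    using \<open>r > 0\<close> \<open>m \<ge> 0\<close> by (simp add: D_def W_def)
  have "blowup_measure N \<Omega> w r = density lebesgue (\<lambda>y. ennreal (D y))"
    unfolding blowup_measure_def m_def[symmetric]
  proof (rule arg_cong[where f = "density lebesgue"], rule ext)
    fix y
    show "indicator (nball N 0 1) y * ennreal (w (r *\<^sub>R y) * r ^ DIM('a) / m) = ennreal (D y)"
    proof (cases "y \<in> nball N 0 1")
      case True
      then have "r *\<^sub>R y \<in> \<Omega>"
        using nball_scale \<Omega> by blast
      then show ?thesis
        using True \<open>r > 0\<close> \<open>m \<ge> 0\<close>
        by (auto simp: D_def W_def max_def ennreal_neg divide_nonpos_nonneg mult_nonpos_nonneg)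
    qed (simp add: D_def)
  qed
  then have "(LINT y|blowup_measure N \<Omega> w r. \<phi> y) = (LINT y|lebesgue. D y * \<phi> y)"
    using \<open>\<And>y. D y \<ge> 0\<close> by (simp add: integral_density)
  \<comment> \<open>Replacing y by \<open>(1 / r) *\<^sub>R (r *\<^sub>R y)\<close> exhibits the
    integrand as a function of \<open>r *\<^sub>R y\<close>, as the change of variables
    requires.\<close>
  also have "\<dots> = r ^ DIM('a) * (LINT y|lebesgue.
      indicator (nball N 0 r) (r *\<^sub>R y) * (W (r *\<^sub>R y) * \<phi> ((1 / r) *\<^sub>R (r *\<^sub>R y)))) / m"
    unfolding integral_mult_right_zero[symmetric] integral_divide_zero[symmetric]
    using nball_scale \<open>r > 0\<close>
    by (intro Bochner_Integration.integral_cong) (auto simp: D_def indicator_def)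
  also have "\<dots> = (LINT y|lebesgue. indicator (nball N 0 r) y * (W y * \<phi> ((1 / r) *\<^sub>R y))) / m"
    using lebesgue_integral_scaling[of "\<lambda>y. indicator (nball N 0 r) y * (W y * \<phi> ((1 / r) *\<^sub>R y))" r] \<open>r > 0\<close>
    by simp
  finally show ?thesis
    by (simp add: set_lebesgue_integral_def W_def m_def)
qed

section \<open>Integrability, bounds and positivity on a set\<close>

text \<open>Differentiability near the origin gives continuity of \<open>u\<close> on a small
  compact \<open>K\<close>: continuity provides measurability on \<open>A\<close>, compactness the
  bound.\<close>

lemma
  fixes W h :: "'a::euclidean_space \<Rightarrow> real"
  assumes W: "integrable lebesgue W" and A: "A \<in> sets borel" "A \<subseteq> K"
    and K: "compact K" "continuous_on K h"
  shows set_borel_measurable_continuous_on_compact: "set_borel_measurable lebesgue A h"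
    and set_integrable_mult_continuous_on_compact: "set_integrable lebesgue A (\<lambda>x. W x * h x)"
proof -
  have "continuous_on A h"
    using A K continuous_on_subset by blast
  then have "(\<lambda>x. indicator A x *\<^sub>R h x) \<in> borel_measurable borel"
    using A by (intro borel_measurable_continuous_on_indicator)
  then show *: "set_borel_measurable lebesgue A h"
    unfolding set_borel_measurable_def by (intro measurable_completion) simp
  have "bounded (h ` K)"
    using K by (intro compact_imp_bounded compact_continuous_image)
  then obtain b where "\<And>x. x \<in> K \<Longrightarrow> \<bar>h x\<bar> \<le> b"
    unfolding bounded_iff by auto
  then show "set_integrable lebesgue A (\<lambda>x. W x * h x)"
    using A by (intro set_integrable_mult_bounded[OF W _ *]) auto
qed

text \<open>Dividing by the mass of \<open>W\<close> over \<open>A\<close> leaves just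
  \<open>K\<close>, so a uniform bound for the Taylor remainder passes to its weighted
  average.\<close>

lemma set_integral_mult_bound:
  fixes W f :: "'a \<Rightarrow> real"
  assumes W: "integrable M W" "\<And>x. W x \<ge> 0" and A: "A \<in> sets M"
    and f: "set_borel_measurable M A f" and K: "\<And>x. x \<in> A \<Longrightarrow> \<bar>f x\<bar> \<le> K"
  shows "\<bar>LINT x:A|M. W x * f x\<bar> \<le> K * (LINT x:A|M. W x)"
proof -
  have "\<bar>LINT x:A|M. W x * f x\<bar> \<le> (LINT x|M. K * (indicator A x *\<^sub>R W x))"
    unfolding set_lebesgue_integral_def real_norm_def[symmetric]
  proof (rule order_trans[OF integral_norm_bound integral_mono_AE])
    show "integrable M (\<lambda>x. norm (indicator A x *\<^sub>R (W x * f x)))"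
      using set_integrable_mult_bounded[OF W(1) A f K] by (simp add: set_integrable_def)
    show "integrable M (\<lambda>x. K * (indicator A x *\<^sub>R W x))"
      using integrable_mult_indicator[OF A W(1)] by (intro integrable_mult_right)
    show "AE x in M. norm (indicator A x *\<^sub>R (W x * f x)) \<le> K * (indicator A x *\<^sub>R W x)"
      using K W(2) by (intro AE_I2) (auto simp: indicator_def abs_mult mult.commute[of K] mult_left_mono)
  qed
  then show ?thesis
    by (simp add: set_lebesgue_integral_def)
qed

text \<open>A nonnegative function with integral 0 vanishes almost everywhere, which would make
  \<open>A\<close> null. Applied to small balls, this ensures that the averages are not divisions by
  0.\<close>

lemma set_lebesgue_integral_pos:
  fixes W :: "'a \<Rightarrow> real"
  assumes W: "integrable M W" "\<And>x. W x \<ge> 0" and A: "A \<in> sets M" "emeasure M A \<noteq> 0"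
    and pos: "AE x in M. x \<in> A \<longrightarrow> W x > 0"
  shows "(LINT x:A|M. W x) > 0"
proof (rule ccontr)
  assume "\<not> ?thesis"
  moreover have "(LINT x:A|M. W x) \<ge> 0"
    unfolding set_lebesgue_integral_def using W(2) by (intro integral_nonneg_AE) auto
  ultimately have "(LINT x|M. indicator A x *\<^sub>R W x) = 0"
    by (simp add: set_lebesgue_integral_def)
  then have "AE x in M. indicator A x *\<^sub>R W x = 0"
    using W integrable_mult_indicator[OF A(1) W(1)] by (subst (asm) integral_nonneg_eq_0_iff_AE) auto
  with pos have "AE x in M. x \<notin> A"
    by eventually_elim auto
  then have "emeasure M A = 0"
    using A(1) by (subst (asm) AE_iff_null_sets[symmetric]) (auto simp: null_sets_def)
  with A(2) show False
    by simp
qed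

section \<open>Quadratic forms and the moment matrix\<close>

lemma integral_quadratic_form:
  fixes N :: "real ^ 'n \<Rightarrow> real" and A :: "real ^ 'n ^ 'n"
  assumes N: "is_norm N" and \<nu>: "radon_measure \<nu>"
  shows "(LINT y:nball N 0 1|\<nu>. (A *v y) \<bullet> y) = trace (moment_matrix N \<nu> ** A)"
proof -
  let ?B = "nball N 0 1"
  have sets[measurable_cong]: "sets \<nu> = sets borel"
    using \<nu> by (simp add: radon_measure_def)
  have B[measurable]: "?B \<in> sets \<nu>"
    using open_nball[OF N] by (simp add: sets)
  obtain C where C: "C > 0" "\<And>x. norm x \<le> C * N x"
    using is_norm_bounds[OF N] by metis
  have norm_le: "norm y \<le> C" if "y \<in> ?B" for y
    using norm_less_nball[OF C that] by simp
  then have "?B \<subseteq> cball 0 C"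
    by auto
  \<comment> \<open>The Radon property gives finite mass on compact sets, hence the passage through
    a closed Euclidean ball. With bounded coordinate products this makes every moment a convergent
    integral.\<close>
  then have "emeasure \<nu> ?B \<le> emeasure \<nu> (cball 0 C)"
    by (intro emeasure_mono) (auto simp: sets)
  also have "\<dots> < \<infinity>"
    using \<nu> unfolding radon_measure_def by (meson compact_cball)
  finally have fin: "emeasure \<nu> ?B < \<infinity>" .
  have int: "set_integrable \<nu> ?B (\<lambda>y. y $ i * y $ j)" for i j
    unfolding set_integrable_def
  proof (rule integrableI_bounded_set_indicator[where B = "C * C"])
    show "(\<lambda>y. y $ i * y $ j) \<in> borel_measurable \<nu>"
      unfolding measurable_cong_sets[OF sets refl]
      by (intro borel_measurable_continuous_onI continuous_intros)
    have "\<bar>y $ i * y $ j\<bar> \<le> C * C" if "y \<in> ?B" for y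
      unfolding abs_mult using norm_le[OF that] component_le_norm_cart[of y i] component_le_norm_cart[of y j] C
      by (intro mult_mono) auto
    then show "AE y in \<nu>. y \<in> ?B \<longrightarrow> norm (y $ i * y $ j) \<le> C * C"
      by auto
  qed (use B fin in auto)
  have "(A *v y) \<bullet> y = (\<Sum>i\<in>UNIV. \<Sum>j\<in>UNIV. A $ i $ j * (y $ j * y $ i))" for y
    by (simp add: inner_vec_def matrix_vector_mult_def sum_distrib_right mult.assoc)
  then have "(LINT y:?B|\<nu>. (A *v y) \<bullet> y)
    = (LINT y|\<nu>. (\<Sum>i\<in>UNIV. \<Sum>j\<in>UNIV. A $ i $ j * (indicator ?B y *\<^sub>R (y $ j * y $ i))))"
    by (simp add: set_lebesgue_integral_def sum_distrib_left mult.left_commute)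
  also have "\<dots> = (\<Sum>i\<in>UNIV. \<Sum>j\<in>UNIV. A $ i $ j * (LINT y:?B|\<nu>. y $ j * y $ i))"
    using int unfolding set_integrable_def set_lebesgue_integral_def
    by (simp add: Bochner_Integration.integral_sum)
  also have "\<dots> = trace (moment_matrix N \<nu> ** A)"
    unfolding trace_def matrix_matrix_mult_def moment_matrix_def
    by (subst sum.swap) (simp add: mult.commute)
  finally show ?thesis .
qed

section \<open>Limits of the linear, quadratic and remainder terms\<close>

theorem proposition5p8:
  fixes N :: "real ^ 'n \<Rightarrow> real"
    and \<Omega> :: "(real ^ 'n) set"
    and w :: "real ^ 'n \<Rightarrow> real"
    and \<nu> :: "(real ^ 'n) measure"
    and u :: "real ^ 'n \<Rightarrow> real"
  assumes "is_norm N"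
    and "open \<Omega>" and "0 \<in> \<Omega>"
    and "vanishing_weight N \<Omega> w"
    and "infinitesimally_even N w"
    and "radon_measure \<nu>"
    and "emeasure \<nu> (UNIV - nball N 0 1) = 0"
    and "weakly_converges (blowup_measure N \<Omega> w) \<nu> (at_right 0)"
    and "twice_differentiable_at u 0"
  shows "amv_laplacian_exists N (weighted_lebesgue \<Omega> w) u 0 \<and>
         amv_laplacian N (weighted_lebesgue \<Omega> w) u 0 =
           1 / 2 * trace (moment_matrix N \<nu> ** hessian u 0)"
proof -
  note N = \<open>is_norm N\<close>
  obtain C where C: "C > 0" "\<And>x. norm x \<le> C * N x" and N_cont: "continuous_on UNIV N"
    using is_norm_bounds[OF N] by metis

  define B where "B = nball N 0"
  define W where "W x = indicator \<Omega> x * max 0 (w x)" for x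
  define m where "m r = (LINT y:B r|lebesgue. W y)" for r
  define g where "g = gradient u 0"
  define q where "q y = (hessian u 0 *v y) \<bullet> y" for y
  define \<rho> where "\<rho> y = u y - u 0 - g \<bullet> y - q y / 2" for y

  have w_int: "integrable (lebesgue_on \<Omega>) w"
    using assms(4) by (simp add: vanishing_weight_def)
  then have w_meas: "w \<in> borel_measurable (lebesgue_on \<Omega>)"
    by simp
  have W_int: "integrable lebesgue W"
  proof -
    have "integrable (lebesgue_on \<Omega>) (\<lambda>x. max 0 (w x))"
      using w_int by (intro Bochner_Integration.integrable_max) auto
    then show ?thesis
      using \<open>open \<Omega>\<close> unfolding W_def by (subst (asm) integrable_restrict_space) auto
  qed
  have W_nonneg: "W x \<ge> 0" for x
    by (simp add: W_def)
  have "AE x in lebesgue_on \<Omega>. 0 < w x"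
    using assms(4) by (simp add: vanishing_weight_def)
  then have W_eq: "AE x in lebesgue. x \<in> \<Omega> \<longrightarrow> W x = w x \<and> 0 < w x"
    using \<open>open \<Omega>\<close> by (subst (asm) AE_restrict_space_iff) (auto simp: W_def elim!: eventually_mono)
  \<comment> \<open>Evenness involves \<open>w (- x)\<close>, so the exceptional null set has to be
    reflected as well.\<close>
  from AE_lebesgue_scaling[OF this, of "-1"]
  have W_eq_minus: "AE x in lebesgue. - x \<in> \<Omega> \<longrightarrow> W (- x) = w (- x)"
    by (auto elim!: eventually_mono)

  have B_borel: "B r \<in> sets borel" for r
    unfolding B_def using open_nball[OF N] by simp
  then have B_sets: "B r \<in> sets lebesgue" for r
    by simp
  have B_minus: "- x \<in> B r \<longleftrightarrow> x \<in> B r" for x r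
    using is_norm_minus[OF N, of x] by (simp add: B_def nball_def)
  have norm_B: "norm x \<le> C * r" if "x \<in> B r" for x r
    using norm_less_nball[OF C] that by (force simp: B_def)
  have B_pos: "measure lebesgue (B r) > 0" if "r > 0" for r
    using measure_nball_pos[OF N that] by (simp add: B_def)

  obtain d where d: "d > 0" "\<And>y. y \<in> ball 0 d \<Longrightarrow> u differentiable (at y)"
    using assms(9) by (auto simp: twice_differentiable_at_def eventually_nhds_metric)
  \<comment> \<open>Halving the radius gives a compact ball inside the open ball where
    \<open>u\<close> is differentiable.\<close>
  define K where "K = cball (0 :: real ^ 'n) (d / 2)"
  have K: "compact K" "K \<subseteq> ball 0 d"
    using d by (auto simp: K_def)
  have u_cont: "continuous_on K u"
    using d(2) K(2) by (meson continuous_at_imp_continuous_on differentiable_imp_continuous_within subsetD)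
  have q_cont: "continuous_on S q" for S
    unfolding q_def by (intro continuous_intros matrix_vector_mult_linear_continuous_on)
  have \<rho>_cont: "continuous_on K \<rho>"
    unfolding \<rho>_def by (intro continuous_intros u_cont q_cont) simp

  have small: "\<forall>\<^sub>F r in at_right 0. 0 < r \<and> B r \<subseteq> \<Omega> \<and> B r \<subseteq> K"
  proof -
    have "\<forall>\<^sub>F r in at_right 0. nball N 0 r \<subseteq> \<Omega> \<inter> ball 0 (d / 2)"
      using assms d by (intro eventually_nball_subset) auto
    moreover have "\<forall>\<^sub>F r in at_right (0::real). 0 < r"
      by (rule eventually_at_right_less)
    ultimately show ?thesis
    proof eventually_elim
      case (elim r)
      have "ball 0 (d / 2) \<subseteq> K"
        by (auto simp: K_def)
      with elim show ?case
        unfolding B_def by blast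
    qed
  qed

  have m_pos: "m r > 0" if "0 < r" "B r \<subseteq> \<Omega>" for r
    unfolding m_def
  proof (rule set_lebesgue_integral_pos[OF W_int W_nonneg B_sets])
    show "emeasure lebesgue (B r) \<noteq> 0"
      using B_pos[OF \<open>0 < r\<close>] by (auto simp: measure_def)
    show "AE x in lebesgue. x \<in> B r \<longrightarrow> 0 < W x"
      using W_eq by eventually_elim (use that in auto)
  qed
  have m_eq: "measure (weighted_lebesgue \<Omega> w) (B r) = m r" if "B r \<subseteq> \<Omega>" for r
    using measure_weighted_lebesgue[OF \<open>open \<Omega>\<close> B_sets that w_meas] by (simp add: m_def W_def)

  \<comment> \<open>All three terms carry the normalisation of the AMV quotient, with
    \<open>m r\<close> as the mass of the ball.\<close>
  define L where "L r = (LINT y:B r|lebesgue. W y * (g \<bullet> y)) / (r\<^sup>2 * m r)" for r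
  define Q where "Q r = (LINT y:B r|lebesgue. W y * q y) / (r\<^sup>2 * m r)" for r
  define R where "R r = (LINT y:B r|lebesgue. W y * \<rho> y) / (r\<^sup>2 * m r)" for r

  have decomposition: "set_integrable (weighted_lebesgue \<Omega> w) (B r) (\<lambda>y. u y - u 0) \<and>
      amv_quotient N (weighted_lebesgue \<Omega> w) u 0 r = L r + 1 / 2 * Q r + R r"
    if r: "0 < r \<and> B r \<subseteq> \<Omega> \<and> B r \<subseteq> K" for r
  proof -
    have int: "set_integrable lebesgue (B r) (\<lambda>y. W y * h y)" if "continuous_on K h" for h
      using r K that by (intro set_integrable_mult_continuous_on_compact[OF W_int B_borel]) auto
    have du: "continuous_on K (\<lambda>y. u y - u 0)"
      by (intro continuous_intros u_cont)
    then have du_meas: "set_borel_measurable lebesgue (B r) (\<lambda>y. u y - u 0)"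
      using r K by (intro set_borel_measurable_continuous_on_compact[OF W_int B_borel]) auto
    have du_int: "set_integrable (weighted_lebesgue \<Omega> w) (B r) (\<lambda>y. u y - u 0)"
      using set_integrable_weighted_lebesgue[OF \<open>open \<Omega>\<close> B_sets _ w_meas du_meas] r int[OF du]
      by (simp add: W_def)
    have "(LINT y:B r|weighted_lebesgue \<Omega> w. u y - u 0) = (LINT y:B r|lebesgue. W y * (u y - u 0))"
      using set_integral_weighted_lebesgue[OF \<open>open \<Omega>\<close> B_sets _ w_meas du_meas] r
      by (simp add: W_def)
    also have "\<dots> = (LINT y:B r|lebesgue. (W y * (g \<bullet> y) + 1 / 2 * (W y * q y)) + W y * \<rho> y)"
      by (simp add: \<rho>_def algebra_simps)
    also have "\<dots> = (LINT y:B r|lebesgue. W y * (g \<bullet> y)) + 1 / 2 * (LINT y:B r|lebesgue. W y * q y)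
        + (LINT y:B r|lebesgue. W y * \<rho> y)"
    proof -
      \<comment> \<open>Splitting a Bochner integral requires each summand to be integrable; each is
        \<open>W\<close> times a function continuous on \<open>K\<close>.\<close>
      have 1: "set_integrable lebesgue (B r) (\<lambda>y. W y * (g \<bullet> y))"
        by (intro int continuous_intros)
      have 2: "set_integrable lebesgue (B r) (\<lambda>y. 1 / 2 * (W y * q y))"
        by (intro set_integrable_mult_right int q_cont)
      show ?thesis
        unfolding set_integral_add(2)[OF set_integral_add(1)[OF 1 2] int[OF \<rho>_cont]]
          set_integral_add(2)[OF 1 2] by simp
    qed
    finally have "amv_quotient N (weighted_lebesgue \<Omega> w) u 0 r = L r + 1 / 2 * Q r + R r"
      using m_eq r
      by (simp add: amv_quotient_def avg_integral_def L_def Q_def R_def add_divide_distrib ac_simps flip: B_def)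
    with du_int show ?thesis
      by blast
  qed

  have "(L \<longlongrightarrow> 0) (at_right 0)"
  proof -
    define E where
      "E r = real_of_ereal (esssup (lebesgue_on (B r)) (\<lambda>x. ereal \<bar>w x - w (- x)\<bar>))" for r
    define a where "a r = r * avg_integral lebesgue (B r) w" for r
    obtain U c where U: "open U" "0 \<in> U" "AE x in lebesgue_on U. \<bar>w x\<bar> \<le> c"
      using assms(5) by (auto simp: infinitesimally_even_def)
    have "E \<in> o[at_right 0](a)"
      using assms(5) by (simp add: infinitesimally_even_def E_def[abs_def] a_def[abs_def] B_def)
    then have lim: "((\<lambda>r. E r / a r) \<longlongrightarrow> 0) (at_right 0)"
      by (rule smalloD_tendsto)
    have "\<forall>\<^sub>F r in at_right 0. AE x in lebesgue. x \<in> B r \<longrightarrow> \<bar>w x - w (- x)\<bar> \<le> E r"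
      using eventually_AE_le_real_esssup[OF N assms(2,3) w_meas U] by (simp add: E_def B_def)
    with small have "\<forall>\<^sub>F r in at_right 0. norm (L r) \<le> norm (E r / a r) * (norm g * C / 2)"
    proof eventually_elim
      case (elim r)
      have "AE x in lebesgue. x \<in> nball N 0 r \<longrightarrow> \<bar>W x - W (- x)\<bar> \<le> E r"
        using elim(2) W_eq W_eq_minus
      proof eventually_elim
        case (elim x)
        then show ?case
          using \<open>0 < r \<and> B r \<subseteq> \<Omega> \<and> B r \<subseteq> K\<close> B_minus[of x r] unfolding B_def by auto
      qed
      from linear_term_bound[OF N W_int _ C this, of g]
      have "\<bar>LINT y:B r|lebesgue. W y * (g \<bullet> y)\<bar> \<le> E r * (norm g * C * r) * measure lebesgue (B r) / 2"
        using elim(1) by (simp add: B_def)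
      then have "\<bar>L r\<bar> \<le> E r * (norm g * C * r) * measure lebesgue (B r) / 2 / (r\<^sup>2 * m r)"
        unfolding L_def abs_divide using m_pos[of r] elim(1)
        by (simp only: abs_of_pos mult_pos_pos zero_less_power divide_right_mono less_imp_le)
      \<comment> \<open>One power of r from the linear form cancels against the two in the
        denominator, and the Lebesgue measure of the ball turns \<open>m r\<close> into an average:
        this is the normalisation in infinitesimal evenness.\<close>
      also have "\<dots> = E r / (r * (m r / measure lebesgue (B r))) * (norm g * C / 2)"
        using m_pos[of r] elim(1) B_pos[of r] by (simp add: field_simps power2_eq_square)
      also have "m r / measure lebesgue (B r) = avg_integral lebesgue (B r) w"
      proof -
        \<comment> \<open>Evenness averages \<open>w\<close> itself, while \<open>m\<close>
          integrates \<open>W\<close>. They agree almost everywhere on the ball, and the extra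
          indicator supplies measurability of the restricted \<open>w\<close>.\<close>
        have "(\<lambda>x. indicator \<Omega> x *\<^sub>R w x) \<in> borel_measurable lebesgue"
          using w_meas \<open>open \<Omega>\<close> by (subst (asm) borel_measurable_restrict_space_iff) auto
        then have "(\<lambda>x. indicator (B r) x *\<^sub>R (indicator \<Omega> x *\<^sub>R w x)) \<in> borel_measurable lebesgue"
          using B_sets[of r] by measurable
        also have "(\<lambda>x. indicator (B r) x *\<^sub>R (indicator \<Omega> x *\<^sub>R w x)) = (\<lambda>x. indicator (B r) x *\<^sub>R w x)"
          using elim(1) by (auto simp: indicator_def fun_eq_iff)
        finally have "(LINT x:B r|lebesgue. W x) = (LINT x:B r|lebesgue. w x)"
          unfolding set_lebesgue_integral_def using W_int B_sets[of r] W_eq elim(1)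
          by (intro integral_cong_AE) (auto simp: indicator_def elim!: eventually_mono)
        then show ?thesis
          by (simp add: m_def avg_integral_def)
      qed
      finally have "\<bar>L r\<bar> \<le> E r / a r * (norm g * C / 2)"
        by (simp add: a_def)
      also have "\<dots> \<le> \<bar>E r / a r\<bar> * (norm g * C / 2)"
        using C(1) by (intro mult_right_mono abs_ge_self) simp
      finally show ?case
        by simp
    qed
    with lim show ?thesis
      by (rule tendsto_0_le)
  qed

  moreover have "(Q \<longlongrightarrow> trace (moment_matrix N \<nu> ** hessian u 0)) (at_right 0)"
  proof -
    \<comment> \<open>The cutoff is 1 where \<open>N y \<le> 1\<close> and 0 where
      \<open>N y \<ge> 2\<close>, so the test function has compact support.\<close>
    define \<phi> where "\<phi> y = max 0 (min 1 (2 - N y)) * q y" for y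
    have \<phi>_cont: "continuous_on UNIV \<phi>"
      unfolding \<phi>_def by (intro continuous_intros N_cont q_cont)
    have \<phi>_B: "\<phi> y = q y" if "y \<in> B 1" for y
      using that by (simp add: \<phi>_def B_def nball_def)
    have "{y. \<phi> y \<noteq> 0} \<subseteq> B 2"
      by (auto simp: \<phi>_def B_def nball_def)
    moreover have "bounded (B 2)"
      using norm_B by (auto simp: bounded_iff)
    ultimately have "compact (closure {y. \<phi> y \<noteq> 0})"
      using bounded_subset by (auto simp: compact_closure)
    with \<phi>_cont have "((\<lambda>r. LINT y|blowup_measure N \<Omega> w r. \<phi> y) \<longlongrightarrow> (LINT y|\<nu>. \<phi> y)) (at_right 0)"
      using assms(8) by (simp add: weakly_converges_def)
    moreover have "\<forall>\<^sub>F r in at_right 0. (LINT y|blowup_measure N \<Omega> w r. \<phi> y) = Q r"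
      using small
    proof eventually_elim
      case (elim r)
      \<comment> \<open>Homogeneity of degree 2 of \<open>q\<close> produces the factor 1/r^2 of the
        AMV quotient.\<close>
      have scale: "\<phi> ((1 / r) *\<^sub>R y) = (1 / r\<^sup>2) * q y" if "y \<in> B r" for y
      proof -
        have "(1 / r) *\<^sub>R y \<in> B 1"
          using that elim by (simp add: B_def nball_def is_norm_scaleR[OF N])
        then have "\<phi> ((1 / r) *\<^sub>R y) = q ((1 / r) *\<^sub>R y)"
          by (rule \<phi>_B)
        then show ?thesis
          by (simp add: q_def matrix_vector_mult_scaleR power2_eq_square)
      qed
      have "(LINT y|blowup_measure N \<Omega> w r. \<phi> y)
          = (LINT y:B r|lebesgue. W y * \<phi> ((1 / r) *\<^sub>R y)) / m r"
        using integral_blowup_measure[OF N \<open>open \<Omega>\<close> _ _ w_meas \<phi>_cont, of r] elim m_eq[of r]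
        by (simp add: B_def W_def)
      also have "(LINT y:B r|lebesgue. W y * \<phi> ((1 / r) *\<^sub>R y)) = (LINT y:B r|lebesgue. (1 / r\<^sup>2) * (W y * q y))"
        using scale by (intro set_lebesgue_integral_cong) (auto simp: B_sets)
      also have "\<dots> / m r = Q r"
        unfolding set_integral_mult_right by (simp add: Q_def)
      finally show ?case .
    qed
    ultimately have "(Q \<longlongrightarrow> (LINT y|\<nu>. \<phi> y)) (at_right 0)"
      by (rule Lim_transform_eventually)
    \<comment> \<open>Since \<nu> gives no mass to the complement of the open unit ball, bounding
      sphere included, the cutoff region contributes nothing.\<close>
    also have "(LINT y|\<nu>. \<phi> y) = (LINT y:B 1|\<nu>. q y)"
      unfolding set_lebesgue_integral_def
    proof (rule integral_cong_AE)
      have sets[measurable_cong]: "sets \<nu> = sets borel"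
        using assms(6) by (simp add: radon_measure_def)
      show "\<phi> \<in> borel_measurable \<nu>"
        unfolding measurable_cong_sets[OF sets refl] by (intro borel_measurable_continuous_onI \<phi>_cont)
      show "(\<lambda>y. indicator (B 1) y *\<^sub>R q y) \<in> borel_measurable \<nu>"
        unfolding measurable_cong_sets[OF sets refl]
        by (intro borel_measurable_continuous_on_indicator B_borel q_cont)
      have "UNIV - B 1 \<in> null_sets \<nu>"
        using assms(7) B_borel[of 1] by (auto simp: null_sets_def sets B_def)
      then have "AE y in \<nu>. y \<in> B 1"
        by (rule AE_I') auto
      then show "AE y in \<nu>. \<phi> y = indicator (B 1) y *\<^sub>R q y"
        by eventually_elim (simp add: \<phi>_B)
    qed
    also have "\<dots> = trace (moment_matrix N \<nu> ** hessian u 0)"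
      unfolding B_def q_def by (rule integral_quadratic_form[OF N assms(6)])
    finally show ?thesis .
  qed

  moreover have "(R \<longlongrightarrow> 0) (at_right 0)"
  proof (rule tendstoI)
    fix e :: real assume "e > 0"
    \<comment> \<open>Chosen so that \<open>\<epsilon> * (C * r)\<^sup>2 / r\<^sup>2\<close> equals
      \<open>e / 2\<close>, strictly below \<open>e\<close>.\<close>
    define \<epsilon> where "\<epsilon> = e / (2 * C\<^sup>2)"
    have "\<epsilon> > 0"
      using \<open>e > 0\<close> C by (simp add: \<epsilon>_def)
    \<comment> \<open>The Taylor estimate speaks of the derivative as a linear map,
      \<open>hessian\<close> of its matrix.\<close>
    have "frechet_derivative (gradient u) (at 0) = (\<lambda>y. hessian u 0 *v y)"
    proof -
      have "gradient u differentiable (at 0)"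
        using assms(9) by (simp add: twice_differentiable_at_def)
      then have "(gradient u has_derivative (\<lambda>y. hessian u 0 *v y)) (at 0)"
        unfolding hessian_def by (simp flip: jacobian_works)
      then show ?thesis
        using frechet_derivative_at by metis
    qed
    then have "\<forall>\<^sub>F y in nhds 0. \<bar>\<rho> y\<bar> \<le> \<epsilon> * (norm y)\<^sup>2"
      using second_order_taylor[OF assms(9) \<open>\<epsilon> > 0\<close>] by (simp add: \<rho>_def g_def q_def)
    then obtain S where S: "open S" "0 \<in> S" "\<And>y. y \<in> S \<Longrightarrow> \<bar>\<rho> y\<bar> \<le> \<epsilon> * (norm y)\<^sup>2"
      unfolding eventually_nhds by blast
    have "\<forall>\<^sub>F r in at_right 0. B r \<subseteq> S"
      unfolding B_def using S by (intro eventually_nball_subset[OF N])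
    with small show "\<forall>\<^sub>F r in at_right 0. dist (R r) 0 < e"
    proof eventually_elim
      case (elim r)
      have "m r > 0"
        using elim m_pos by blast
      have "\<bar>\<rho> y\<bar> \<le> \<epsilon> * (C * r)\<^sup>2" if "y \<in> B r" for y
      proof -
        have "\<bar>\<rho> y\<bar> \<le> \<epsilon> * (norm y)\<^sup>2"
          using elim that by (intro S) auto
        also have "\<dots> \<le> \<epsilon> * (C * r)\<^sup>2"
          using norm_B[OF that] \<open>\<epsilon> > 0\<close> by (intro mult_left_mono power_mono) auto
        finally show ?thesis .
      qed
      moreover have "set_borel_measurable lebesgue (B r) \<rho>"
        using elim K \<rho>_cont
        by (intro set_borel_measurable_continuous_on_compact[OF W_int B_borel]) auto
      ultimately have "\<bar>LINT y:B r|lebesgue. W y * \<rho> y\<bar> \<le> \<epsilon> * (C * r)\<^sup>2 * m r"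
        unfolding m_def by (intro set_integral_mult_bound W_int W_nonneg B_sets)
      then have "\<bar>R r\<bar> \<le> \<epsilon> * (C * r)\<^sup>2 * m r / (r\<^sup>2 * m r)"
        unfolding R_def abs_divide using \<open>m r > 0\<close> elim(1)
        by (simp only: abs_of_pos mult_pos_pos zero_less_power divide_right_mono less_imp_le)
      also have "\<dots> = e / 2"
        using \<open>m r > 0\<close> elim C by (simp add: \<epsilon>_def power_mult_distrib)
      finally show ?case
        using \<open>e > 0\<close> by simp
    qed
  qed

  ultimately have "((\<lambda>r. L r + 1 / 2 * Q r + R r)
      \<longlongrightarrow> 0 + 1 / 2 * trace (moment_matrix N \<nu> ** hessian u 0) + 0) (at_right 0)"
    by (intro tendsto_intros)
  moreover have "\<forall>\<^sub>F r in at_right 0.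
      L r + 1 / 2 * Q r + R r = amv_quotient N (weighted_lebesgue \<Omega> w) u 0 r"
    using small by eventually_elim (use decomposition in auto)
  ultimately have lim: "(amv_quotient N (weighted_lebesgue \<Omega> w) u 0
      \<longlongrightarrow> 1 / 2 * trace (moment_matrix N \<nu> ** hessian u 0)) (at_right 0)"
    by (simp add: Lim_transform_eventually)
  moreover have "\<forall>\<^sub>F r in at_right 0.
      set_integrable (weighted_lebesgue \<Omega> w) (nball N 0 r) (\<lambda>y. u y - u 0)"
    using small by eventually_elim (use decomposition B_def in auto)
  moreover have "amv_laplacian N (weighted_lebesgue \<Omega> w) u 0
      = 1 / 2 * trace (moment_matrix N \<nu> ** hessian u 0)"
    unfolding amv_laplacian_def using lim by (intro tendsto_Lim) simp_all
  ultimately show ?thesis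
    unfolding amv_laplacian_exists_def by blast
qed

end
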